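(* Consider the treasure hunt problem in the plane. There exists a deterministic algorithm for the agent (which knows neither $D$ nor $\beta$) such that for every constant $\beta$ with $0<\beta<2\pi$ there exist constants $\epsilon>0$ and $C>0$ (depending on $\beta$) with the following property: for every real $D>1$, every position of the treasure at distance at most $D$ from the agent's initial position, and every sequence of hints consistent with the treasure's position in which every hint is an angle of size at most $\beta$, the agent finds the treasure after having traveled a total distance at most $C\cdot D^{2-\epsilon}$ (i.e., the cost is $O(D^{2-\epsilon})$).
   Context: Treasure hunt model: a mobile agent and an inert treasure are points in the Euclidean plane. The agent has a compass and a measure of length (so it can maintain a Cartesian coordinate system centered at its starting point $O$). Initially the agent is at distance at most $D$ from the treasure, where $D>1$ is unknown to the agent. The agent makes a sequence of moves, each consisting of moving along a straight segment in a chosen direction for a chosen distance. In the beginning and after each move, the agent receives a hint: a closed angular sector with vertex at the agent's current position, of positive angle smaller than $2\pi$, that contains the treasure (hints may be chosen adversarially, subject only to containing the treasure). The agent finds the treasure as soon as it is (at any point of its trajectory) at distance at most $1$ from it. The cost is the worst-case total length of the agent's trajectory until it finds the treasure. *)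

theory Defs
  imports Complex_Main
begin

text \<open>
  The plane is the type of complex numbers, in the agent's own coordinate system: its starting
  point is 0 and the compass fixes the direction of angle 0.

  A hint is a pair \<open>(\<theta>, \<alpha>)\<close>: the direction of the bounding ray from which the sector is swept
  counterclockwise, and the size of the angle. The vertex is not part of the hint, since it is
  always the agent's current position. Normalising \<open>\<theta>\<close> to \<open>[0, 2\<pi>)\<close> makes the pair a unique code
  for the sector, so that a function of hints is a function of the sectors themselves.
\<close>

type_synonym hint = "real \<times> real"

definition valid_hint :: "hint \<Rightarrow> bool" where
  "valid_hint a \<longleftrightarrow> 0 \<le> fst a \<and> fst a < 2 * pi \<and> 0 < snd a \<and> snd a < 2 * pi"

definition hint_size :: "hint \<Rightarrow> real" where
  "hint_size a = snd a"

definition sector :: "complex \<Rightarrow> hint \<Rightarrow> complex set" where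
  "sector p a = {p + rcis r \<phi> | r \<phi>. 0 \<le> r \<and> fst a \<le> \<phi> \<and> \<phi> \<le> fst a + snd a}"

text \<open>
  A deterministic algorithm maps the hints received so far, oldest first, to the displacement
  vector of the next move. This is all the information the agent has: its earlier moves and
  positions are determined by the earlier hints. The first hint is received before the first move.
\<close>

type_synonym algorithm = "hint list \<Rightarrow> complex"

definition move :: "algorithm \<Rightarrow> (nat \<Rightarrow> hint) \<Rightarrow> nat \<Rightarrow> complex" where
  "move A h i = A (map h [0..<Suc i])"

definition position :: "algorithm \<Rightarrow> (nat \<Rightarrow> hint) \<Rightarrow> nat \<Rightarrow> complex" where
  "position A h i = (\<Sum>j<i. move A h j)"

text \<open>
  Hint sequences are infinite and the run is continued formally after the treasure has been found.
  This loses nothing: any finite sequence of hints containing the treasure (of sizes at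
  most \<open>\<beta> > 0\<close>) extends to an infinite one, and what happens later does not affect the cost.
\<close>

definition consistent_hints :: "algorithm \<Rightarrow> (nat \<Rightarrow> hint) \<Rightarrow> complex \<Rightarrow> bool" where
  "consistent_hints A h t \<longleftrightarrow> (\<forall>i. valid_hint (h i) \<and> t \<in> sector (position A h i) (h i))"

text \<open>
  The point reached after a fraction \<open>s\<close> of move \<open>n\<close> is within distance 1 of the treasure, and the
  path up to that point has length at most \<open>L\<close>.
\<close>

definition finds_within :: "algorithm \<Rightarrow> (nat \<Rightarrow> hint) \<Rightarrow> complex \<Rightarrow> real \<Rightarrow> bool" where
  "finds_within A h t L \<longleftrightarrow>
     (\<exists>n s. 0 \<le> s \<and> s \<le> 1 \<and>
        dist (position A h n + of_real s * move A h n) t \<le> 1 \<and>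
        (\<Sum>j<n. norm (move A h j)) + s * norm (move A h n) \<le> L)"

end

theory Submission
  imports Defs
begin

text \<open>
  The agent searches a square from its centre. A hint of size at most \<open>\<beta>\<close> received there excludes a
  sector of angle at least \<open>2\<pi> - \<beta>\<close>, so for some \<open>k\<close> bounded in terms of \<open>\<beta>\<close> it excludes at least one
  cell of the subdivision into \<open>k \<times> k\<close> cells. Taking the least such \<open>k \<ge> 2\<close> requires no knowledge
  of \<open>\<beta>\<close>. The remaining at most \<open>k\<^sup>2 - 1\<close> cells are searched recursively, depth first, down to side 1.
  The cost satisfies \<open>T(L) \<le> (k\<^sup>2 - 1) (2L + T(L/k))\<close>, whence \<open>T(L) = O(L\<^sup>s)\<close> for some \<open>s < 2\<close>.
  As \<open>D\<close> is unknown, the squares of sides 2, 4, 8, \<dots> centred at the origin are searched in turn.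
\<close>

section \<open>Squares and their subdivisions\<close>

type_synonym csquare = "complex \<times> real"

definition square :: "csquare \<Rightarrow> complex set" where
  "square q = {z. \<bar>Re z - Re (fst q)\<bar> \<le> snd q / 2 \<and> \<bar>Im z - Im (fst q)\<bar> \<le> snd q / 2}"

text \<open>Midpoint of the \<open>i\<close>-th of \<open>k\<close> equal parts of an interval of
  length \<open>L\<close>, measured from the midpoint of that interval.\<close>

definition cell_offset :: "real \<Rightarrow> nat \<Rightarrow> nat \<Rightarrow> real" where
  "cell_offset L k i = L * ((real i + 1/2) / real k - 1/2)"

definition cell :: "csquare \<Rightarrow> nat \<Rightarrow> nat \<times> nat \<Rightarrow> csquare" where
  "cell q k ij = (fst q + Complex (cell_offset (snd q) k (fst ij)) (cell_offset (snd q) k (snd ij)),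
                  snd q / real k)"

definition cells :: "csquare \<Rightarrow> nat \<Rightarrow> csquare list" where
  "cells q k = map (cell q k) (List.product [0..<k] [0..<k])"

lemma length_cells: "length (cells q k) = k\<^sup>2"
  by (simp add: cells_def power2_eq_square)

lemma snd_cells: "q' \<in> set (cells q k) \<Longrightarrow> snd q' = snd q / real k"
  by (auto simp: cells_def cell_def)

lemma center_in_square: "snd q \<ge> 0 \<Longrightarrow> fst q \<in> square q"
  by (simp add: square_def)

lemma dist_le_if_coords_le:
  assumes "\<bar>Re z - Re w\<bar> \<le> e" "\<bar>Im z - Im w\<bar> \<le> e"
  shows "(dist z w)\<^sup>2 \<le> 2 * e\<^sup>2"
proof -
  have "(Re z - Re w)\<^sup>2 \<le> e\<^sup>2" "(Im z - Im w)\<^sup>2 \<le> e\<^sup>2"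
    using assms by (simp_all add: abs_le_square_iff[symmetric])
  then show ?thesis
    by (simp add: dist_norm cmod_power2)
qed

lemma dist_in_square:
  assumes "z \<in> square q" "w \<in> square q"
  shows "(dist z w)\<^sup>2 \<le> 2 * (snd q)\<^sup>2"
  using assms unfolding square_def mem_Collect_eq
  by (intro dist_le_if_coords_le; linarith)

lemma dist_in_square_le:
  assumes "z \<in> square q" "w \<in> square q" "snd q \<ge> 0"
  shows "dist z w \<le> 2 * snd q"
proof (rule power2_le_imp_le)
  have "2 * (snd q)\<^sup>2 \<le> (2 * snd q)\<^sup>2"
    by (simp add: power_mult_distrib)
  then show "(dist z w)\<^sup>2 \<le> (2 * snd q)\<^sup>2"
    using dist_in_square[OF assms(1,2)] by linarith
qed (use assms in simp)

text \<open>Half the diagonal of a unit square is below 1, so visiting the centre settles a small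
  square; this is what ends the recursion.\<close>

lemma dist_center_le_1:
  assumes "z \<in> square q" "snd q \<le> 1"
  shows "dist (fst q) z \<le> 1"
proof (rule power2_le_imp_le)
  have "(dist (fst q) z)\<^sup>2 \<le> 2 * (1/2)\<^sup>2"
    using assms unfolding square_def mem_Collect_eq
    by (intro dist_le_if_coords_le; linarith)
  then show "(dist (fst q) z)\<^sup>2 \<le> 1\<^sup>2"
    by (simp add: power2_eq_square)
qed simp

lemma interval_subdivision:
  assumes "\<bar>x\<bar> \<le> L / 2" "L > 0" "k > 0"
  obtains i where "i < k" "\<bar>x - cell_offset L k i\<bar> \<le> L / real k / 2"
proof -
  define u where "u = (x / L + 1/2) * real k"
  have x: "x = L * (u / real k - 1/2)"
    using assms by (simp add: u_def)
  have "- 1/2 \<le> x / L" "x / L \<le> 1/2"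
    using assms by (auto simp: field_simps abs_le_iff)
  then have "0 \<le> x / L + 1/2" "x / L + 1/2 \<le> 1" by linarith+
  then have u: "0 \<le> u" "u \<le> real k"
    using mult_right_mono[of "x / L + 1/2" 1 "real k"] by (simp_all add: u_def)
  obtain i where i: "i < k" "real i \<le> u" "u \<le> real i + 1"
  proof (cases "u < real k")
    case True
    then have "nat \<lfloor>u\<rfloor> < k" "real (nat \<lfloor>u\<rfloor>) \<le> u" "u \<le> real (nat \<lfloor>u\<rfloor>) + 1"
      using u by linarith+
    then show ?thesis using that by blast
  next
    \<comment> \<open>Here \<open>u = k\<close>, and the floor would give an index one too
      large.\<close>
    case False
    then show ?thesis using that[of "k - 1"] u assms by (auto simp: of_nat_diff)
  qed
  have "x - cell_offset L k i = (u - (real i + 1/2)) * (L / real k)"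
    using assms by (simp add: x cell_offset_def field_simps)
  moreover have "\<bar>u - (real i + 1/2)\<bar> * (L / real k) \<le> 1/2 * (L / real k)"
  proof (rule mult_right_mono)
    show "\<bar>u - (real i + 1/2)\<bar> \<le> 1/2" using i by linarith
  qed (use assms in simp)
  ultimately have "\<bar>x - cell_offset L k i\<bar> \<le> L / real k / 2"
    using assms by (simp add: abs_mult)
  with i that show ?thesis by blast
qed

lemma cells_cover:
  assumes "z \<in> square q" "snd q > 0" "k > 0"
  obtains q' where "q' \<in> set (cells q k)" "z \<in> square q'"
proof -
  have z: "\<bar>Re z - Re (fst q)\<bar> \<le> snd q / 2" "\<bar>Im z - Im (fst q)\<bar> \<le> snd q / 2"
    using assms by (auto simp: square_def)
  obtain i where i: "i < k"
      "\<bar>Re z - Re (fst q) - cell_offset (snd q) k i\<bar> \<le> snd q / real k / 2"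
    using interval_subdivision[OF z(1) assms(2,3)] by blast
  obtain j where j: "j < k"
      "\<bar>Im z - Im (fst q) - cell_offset (snd q) k j\<bar> \<le> snd q / real k / 2"
    using interval_subdivision[OF z(2) assms(2,3)] by blast
  show ?thesis
  proof
    show "cell q k (i, j) \<in> set (cells q k)"
      using i j by (auto simp: cells_def)
    show "z \<in> square (cell q k (i, j))"
      using i j by (simp add: square_def cell_def algebra_simps)
  qed
qed

lemma cell_offset_bounds:
  assumes "i < k" "L > 0"
  shows "\<bar>cell_offset L k i\<bar> \<le> L / 2 - L / real k / 2"
proof -
  have k: "real k > 0" using assms by simp
  have "real i + 1 \<le> real k" using assms by linarith
  then have a: "(real i + 1) / real k \<le> 1" using k by simp
  have b: "0 \<le> real i / real k" by simp
  have "L * ((real i + 1) / real k) \<le> L * 1" "0 \<le> L * (real i / real k)"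
    using mult_left_mono[OF a, of L] mult_left_mono[OF b, of L] assms by simp_all
  moreover have "cell_offset L k i = L * (real i / real k) + L / real k / 2 - L / 2"
    by (simp add: cell_offset_def add_divide_distrib algebra_simps)
  moreover have "L * ((real i + 1) / real k) = L * (real i / real k) + L / real k"
    by (simp add: add_divide_distrib algebra_simps)
  ultimately show ?thesis
    unfolding abs_le_iff by (simp add: algebra_simps)
qed

lemma cells_subset:
  assumes "q' \<in> set (cells q k)" "snd q > 0"
  shows "square q' \<subseteq> square q"
proof -
  obtain i j where ij: "i < k" "j < k" "q' = cell q k (i, j)"
    using assms by (auto simp: cells_def)
  show ?thesis
  proof
    fix z assume "z \<in> square q'"
    then have "\<bar>Re z - Re (fst q) - cell_offset (snd q) k i\<bar> \<le> snd q / real k / 2"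
      "\<bar>Im z - Im (fst q) - cell_offset (snd q) k j\<bar> \<le> snd q / real k / 2"
      by (simp_all add: square_def ij(3) cell_def algebra_simps)
    then show "z \<in> square q"
      using cell_offset_bounds[OF ij(1) assms(2)] cell_offset_bounds[OF ij(2) assms(2)]
      unfolding square_def mem_Collect_eq by linarith
  qed
qed

section \<open>Excluded cells\<close>

text \<open>The point \<open>p - rcis \<rho> (fst a + snd a / 2)\<close> lies on the bisector of the complementary sector.\<close>

lemma sector_dist_antipode:
  assumes w: "w \<in> sector p a" and a: "snd a \<le> \<beta>" and \<beta>: "\<beta> < 2 * pi" and \<rho>: "\<rho> \<ge> 0"
  shows "min 1 (1 + cos (\<beta> / 2)) * \<rho>\<^sup>2 \<le> (dist w (p - rcis \<rho> (fst a + snd a / 2)))\<^sup>2"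
proof -
  obtain r \<phi> where r: "w = p + rcis r \<phi>" "0 \<le> r" "fst a \<le> \<phi>" "\<phi> \<le> fst a + snd a"
    using w by (auto simp: sector_def)
  define \<psi> where "\<psi> = fst a + snd a / 2"
  define e where "e = min 1 (1 + cos (\<beta> / 2))"
  have y: "\<bar>\<phi> - \<psi>\<bar> \<le> \<beta> / 2"
    using r(3,4) a unfolding \<psi>_def abs_le_iff by linarith
  have "cos (\<beta> / 2) \<le> cos \<bar>\<phi> - \<psi>\<bar>"
    using y \<beta> by (intro cos_monotone_0_pi_le) auto
  then have c: "e - 1 \<le> cos (\<phi> - \<psi>)"
    by (simp add: e_def)
  have e: "0 \<le> e" "e \<le> 1"
    using cos_ge_minus_one[of "\<beta> / 2"] unfolding e_def by linarith+
  \<comment> \<open>A convex combination with weights \<open>e\<close> and \<open>1 - e\<close>; the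
    \<open>min\<close> in \<open>e\<close> makes the second weight nonnegative.\<close>
  have "e * \<rho>\<^sup>2 \<le> e * (r\<^sup>2 + \<rho>\<^sup>2) + (1 - e) * (r - \<rho>)\<^sup>2"
    using mult_nonneg_nonneg[of e "r\<^sup>2"] mult_nonneg_nonneg[of "1 - e" "(r - \<rho>)\<^sup>2"] e
    by (simp add: distrib_left)
  also have "\<dots> = r\<^sup>2 + \<rho>\<^sup>2 + 2 * (r * \<rho>) * (e - 1)"
    by (simp add: power2_eq_square algebra_simps)
  also have "\<dots> \<le> r\<^sup>2 + \<rho>\<^sup>2 + 2 * (r * \<rho>) * cos (\<phi> - \<psi>)"
    using c r(2) \<rho> by (intro add_left_mono mult_left_mono) auto
  also have "\<dots> = r\<^sup>2 * ((cos \<phi>)\<^sup>2 + (sin \<phi>)\<^sup>2) + \<rho>\<^sup>2 * ((cos \<psi>)\<^sup>2 + (sin \<psi>)\<^sup>2)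
                    + 2 * (r * \<rho>) * cos (\<phi> - \<psi>)"
    by simp
  \<comment> \<open>The law of cosines, with a plus sign because the second point is
    \<open>p - rcis \<rho> \<psi>\<close>.\<close>
  also have "\<dots> = (r * cos \<phi> + \<rho> * cos \<psi>)\<^sup>2 + (r * sin \<phi> + \<rho> * sin \<psi>)\<^sup>2"
    unfolding cos_diff by (simp only: power2_eq_square) algebra
  also have "\<dots> = (dist w (p - rcis \<rho> \<psi>))\<^sup>2"
    by (simp add: dist_norm r(1) cmod_power2 rcis_def)
  finally show ?thesis
    by (simp add: e_def \<psi>_def)
qed

text \<open>A point a quarter side from the centre, on the bisector of the complement, keeps a
  distance from the sector proportional to the side, while a cell has diameter of the order of the
  side divided by \<open>K\<close>. Hence a large \<open>K\<close> separates the cell around that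
  point from the sector, whatever the square.\<close>

lemma excluded_cell_exists:
  assumes "0 < \<beta>" "\<beta> < 2 * pi"
  obtains K where "K \<ge> 2"
    "\<And>q a. \<lbrakk>snd q > 0; snd a \<le> \<beta>\<rbrakk> \<Longrightarrow> \<exists>q' \<in> set (cells q K). square q' \<inter> sector (fst q) a = {}"
proof -
  define e where "e = min 1 (1 + cos (\<beta> / 2))"
  have "cos pi < cos (\<beta> / 2)"
    using assms by (intro cos_monotone_0_pi) auto
  then have e: "e > 0" by (simp add: e_def)
  \<comment> \<open>Disjointness needs \<open>2 / K^2 < e / 16\<close>, the squared cell diagonal
    against the squared distance at radius \<open>snd q / 4\<close>; as \<open>K \<ge> 1\<close>, it
    is enough that \<open>K > 32 / e\<close>.\<close>
  obtain n where n: "32 / e < real n"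
    using reals_Archimedean2 by blast
  define K where "K = n + 2"
  have K: "K \<ge> 2" "32 / e < real K" using n by (auto simp: K_def)
  have "32 < e * real K" using K e by (simp add: field_simps)
  also have "\<dots> \<le> e * (real K)\<^sup>2"
    using e K by (intro mult_left_mono) (auto simp: power2_eq_square)
  finally have K2: "2 / (real K)\<^sup>2 < e / 16"
    using K by (simp add: field_simps)
  show ?thesis
  proof (rule that[OF K(1)])
    fix q :: csquare and a :: hint
    assume q: "snd q > 0" and a: "snd a \<le> \<beta>"
    define z where "z = fst q - rcis (snd q / 4) (fst a + snd a / 2)"
    have "z \<in> square q"
    proof -
      have "\<bar>Re (rcis (snd q / 4) x)\<bar> \<le> snd q / 4" "\<bar>Im (rcis (snd q / 4) x)\<bar> \<le> snd q / 4" for x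
        using abs_Re_le_cmod[of "rcis (snd q / 4) x"] abs_Im_le_cmod[of "rcis (snd q / 4) x"] q
        by auto
      note b = this[of "fst a + snd a / 2"]
      show ?thesis
        unfolding square_def z_def mem_Collect_eq minus_complex.simps
        using b q by linarith
    qed
    then obtain q' where q': "q' \<in> set (cells q K)" "z \<in> square q'"
      using cells_cover q K by (metis not_numeral_le_zero gr0I)
    have "w \<notin> sector (fst q) a" if "w \<in> square q'" for w
    proof
      assume "w \<in> sector (fst q) a"
      from sector_dist_antipode[OF this a assms(2), of "snd q / 4"]
      have "e * (snd q / 4)\<^sup>2 \<le> (dist w z)\<^sup>2"
        using q by (simp add: e_def z_def)
      also have "\<dots> \<le> 2 * (snd q')\<^sup>2"
        using that q' by (intro dist_in_square) auto
      also have "\<dots> = 2 / (real K)\<^sup>2 * (snd q)\<^sup>2"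
        using snd_cells[OF q'(1)] by (simp add: power_divide)
      also have "\<dots> < e / 16 * (snd q)\<^sup>2"
        using K2 q by (intro mult_strict_right_mono) auto
      finally show False by (simp add: power_divide)
    qed
    with q' show "\<exists>q' \<in> set (cells q K). square q' \<inter> sector (fst q) a = {}"
      by blast
  qed
qed

section \<open>The algorithm\<close>

text \<open>Computed from the square and the hint alone. Requiring \<open>k \<ge> 2\<close> makes
  the side at least halve at each level.\<close>

definition fineness :: "csquare \<Rightarrow> hint \<Rightarrow> nat" where
  "fineness q a = (LEAST k. k \<ge> 2 \<and> (\<exists>q' \<in> set (cells q k). square q' \<inter> sector (fst q) a = {}))"

definition live_cells :: "csquare \<Rightarrow> hint \<Rightarrow> csquare list" where
  "live_cells q a =
     (if snd q \<le> 1 then []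
      else filter (\<lambda>q'. square q' \<inter> sector (fst q) a \<noteq> {}) (cells q (fineness q a)))"

text \<open>
  A state consists of the number of the phase and the stack of the squares still to be searched in
  it. The agent stays at the centre of the topmost square, or at the origin between two phases.
\<close>

type_synonym hunt_state = "nat \<times> csquare list"

text \<open>An empty stack ends a phase: the hint is ignored and the next move has length 0.
  Otherwise the surviving cells replace their parent on top, which makes the search depth
  first.\<close>

fun hunt_step :: "hunt_state \<Rightarrow> hint \<Rightarrow> hunt_state" where
  "hunt_step (n, []) a = (Suc n, [(0, 2 ^ Suc n)])"
| "hunt_step (n, q # qs) a = (n, live_cells q a @ qs)"

fun state_pos :: "hunt_state \<Rightarrow> complex" where
  "state_pos (n, []) = 0"
| "state_pos (n, q # qs) = fst q"

text \<open>An algorithm sees hints only, so the state is replayed from them; the move joins the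
  positions before and after the last hint.\<close>

definition hunt :: algorithm where
  "hunt hs = state_pos (foldl hunt_step (0, []) hs) - state_pos (foldl hunt_step (0, []) (butlast hs))"

section \<open>The run of the algorithm as a sequence of states and positions\<close>

definition state_at :: "(nat \<Rightarrow> hint) \<Rightarrow> nat \<Rightarrow> hunt_state" where
  "state_at h i = foldl hunt_step (0, []) (map h [0..<i])"

definition pos_at :: "(nat \<Rightarrow> hint) \<Rightarrow> nat \<Rightarrow> complex" where
  "pos_at h i = state_pos (state_at h i)"

lemma state_at_0: "state_at h 0 = (0, [])"
  by (simp add: state_at_def)

lemma state_at_Suc: "state_at h (Suc i) = hunt_step (state_at h i) (h i)"
  by (simp add: state_at_def)

lemma move_hunt: "move hunt h i = pos_at h (Suc i) - pos_at h i"
  by (simp add: move_def hunt_def pos_at_def state_at_def)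

lemma position_hunt: "position hunt h i = pos_at h i"
proof -
  have "pos_at h 0 = 0" by (simp add: pos_at_def state_at_0)
  then show ?thesis
    unfolding position_def move_hunt by (simp add: sum_lessThan_telescope)
qed

definition path_length :: "(nat \<Rightarrow> hint) \<Rightarrow> nat \<Rightarrow> nat \<Rightarrow> real" where
  "path_length h i j = (\<Sum>l = i..<j. dist (pos_at h l) (pos_at h (Suc l)))"

lemma path_length_split:
  "i \<le> j \<Longrightarrow> j \<le> l \<Longrightarrow> path_length h i l = path_length h i j + path_length h j l"
  by (simp add: path_length_def sum.atLeastLessThan_concat)

lemma path_length_nonneg: "path_length h i j \<ge> 0"
  by (simp add: path_length_def sum_nonneg)

lemma path_length_Suc: "path_length h i (Suc i) = dist (pos_at h i) (pos_at h (Suc i))"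
  by (simp add: path_length_def)

section \<open>The cost of searching a square\<close>

text \<open>The solution \<open>s\<close> of \<open>K powr s = K^2 - 1\<close>: the growth exponent
  when every square is cut into \<open>K\<close> by \<open>K\<close> cells and one is
  discarded.\<close>

definition search_exponent :: "nat \<Rightarrow> real" where
  "search_exponent K = log (real K) ((real K)\<^sup>2 - 1)"

text \<open>The negative linear term absorbs the cost of the moves between cells in the recursion.\<close>

definition search_cost :: "nat \<Rightarrow> real \<Rightarrow> real" where
  "search_cost K L = 4 * real K ^ 3 * (L powr search_exponent K - L / real K)"

text \<open>From \<open>K < K^2 - 1 < K^2\<close>. The upper bound is the saving over quadratic
  cost; the lower one lets the return moves in \<open>phase\<close> be bounded by the power
  term.\<close>

lemma search_exponent_bounds:
  assumes "K \<ge> 2"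
  shows "1 < search_exponent K" "search_exponent K < 2"
proof -
  have K: "real K \<ge> 2" using assms by simp
  then have "2 * real K \<le> (real K)\<^sup>2" by (simp add: power2_eq_square)
  then have "real K < (real K)\<^sup>2 - 1" using K by linarith
  then show "1 < search_exponent K"
    using K by (simp add: search_exponent_def less_log_iff)
  have "log (real K) ((real K)\<^sup>2 - 1) < log (real K) ((real K)\<^sup>2)"
    using K \<open>real K < (real K)\<^sup>2 - 1\<close> by (subst log_less_cancel_iff) auto
  also have "\<dots> = 2" using K by (simp add: log_nat_power)
  finally show "search_exponent K < 2" by (simp add: search_exponent_def)
qed

text \<open>Squares are cut with varying \<open>k\<close>, so one exponent \<open>s\<close> must
  serve all of them. Here \<open>1 - 1/k^2 \<le> 1 - 1/K^2 = K powr (s - 2) \<le> k powr (s -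
  2)\<close>, the last because \<open>s < 2\<close>; multiply by \<open>k^2\<close>.\<close>

lemma square_minus_1_le_powr:
  assumes "2 \<le> k" "k \<le> K"
  shows "(real k)\<^sup>2 - 1 \<le> real k powr search_exponent K"
proof -
  define s where "s = search_exponent K"
  have s: "1 < s" "s < 2" using search_exponent_bounds assms by (auto simp: s_def)
  have k: "2 \<le> real k" "real k \<le> real K" using assms by auto
  have K1: "1 < (real K)\<^sup>2" using k by (smt (verit) one_less_power zero_less_numeral)
  have Ks: "real K powr s = (real K)\<^sup>2 - 1"
    using k K1 by (simp add: s_def search_exponent_def)
  have "(real k)\<^sup>2 - 1 = (real k)\<^sup>2 * (1 - 1 / (real k)\<^sup>2)"
    using k by (simp add: field_simps)
  also have "\<dots> \<le> (real k)\<^sup>2 * (1 - 1 / (real K)\<^sup>2)"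
    using k by (intro mult_left_mono diff_left_mono divide_left_mono power_mono) auto
  also have "1 - 1 / (real K)\<^sup>2 = real K powr s / real K powr 2"
    using k by (simp add: Ks field_simps)
  also have "\<dots> = real K powr (s - 2)"
    by (simp add: powr_diff)
  also have "(real k)\<^sup>2 * real K powr (s - 2) \<le> (real k)\<^sup>2 * real k powr (s - 2)"
    using k s by (intro mult_left_mono powr_mono2') auto
  also have "\<dots> = real k powr 2 * real k powr (s - 2)"
    using k by simp
  also have "\<dots> = real k powr s"
    by (simp only: powr_add[symmetric]) simp
  finally show ?thesis by (simp add: s_def)
qed

text \<open>Only squares of side above 1 are cut, into at most \<open>K\<close> parts per side, so
  \<open>1 / K\<close> is a lower bound for every side that occurs. There
  \<open>L powr (s - 1) \<ge> K powr (1 - s) \<ge> 1 / K\<close>, as \<open>s < 2\<close>.\<close>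

lemma search_cost_nonneg:
  assumes "K \<ge> 2" "1 / real K \<le> L"
  shows "0 \<le> search_cost K L"
proof -
  define s where "s = search_exponent K"
  have s: "1 < s" "s < 2" using search_exponent_bounds assms by (auto simp: s_def)
  have K: "2 \<le> real K" using assms by simp
  have L: "0 < L" using assms K by (smt (verit) zero_less_divide_1_iff)
  have "1 / real K = real K powr (-1)"
    using K by (simp add: powr_minus_divide)
  also have "\<dots> \<le> real K powr (- (s - 1))"
    using K s by (intro powr_mono) auto
  also have "\<dots> = (1 / real K) powr (s - 1)"
    using K by (simp only: powr_minus_divide powr_divide powr_one_eq_one)
  also have "\<dots> \<le> L powr (s - 1)"
    using assms K s by (intro powr_mono2) auto
  finally have "L * (1 / real K) \<le> L * L powr (s - 1)"
    using L by (intro mult_left_mono) auto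
  also have "\<dots> = L powr s"
    using L by (simp add: powr_diff)
  finally show ?thesis
    by (simp add: search_cost_def s_def)
qed

text \<open>The inductive step of the cost bound: up to \<open>k^2 - 1\<close> cells, each charged a
  move of length at most \<open>2 * L\<close> and its own search. The power terms balance by
  \<open>square_minus_1_le_powr\<close>; the moves are paid by the linear term, which grows by the
  factor \<open>(k^2 - 1) / k \<ge> 3/2\<close>.\<close>

lemma search_cost_recurrence:
  assumes k: "2 \<le> k" "k \<le> K" and L: "1 \<le> L"
  shows "((real k)\<^sup>2 - 1) * (2 * L + search_cost K (L / real k)) \<le> search_cost K L"
proof -
  define s where "s = search_exponent K"
  define N where "N = (real k)\<^sup>2 - 1"
  have K: "2 \<le> real k" "real k \<le> real K" using k by auto
  have k2: "2 * real k \<le> (real k)\<^sup>2" using K by (simp add: power2_eq_square)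
  have N: "0 \<le> N" "N \<le> (real K)\<^sup>2"
    using K k2 power_mono[of "real k" "real K" 2] unfolding N_def by linarith+
  have "N * (L / real k) powr s \<le> real k powr s * (L / real k) powr s"
    using square_minus_1_le_powr[OF k] by (intro mult_right_mono) (auto simp: N_def s_def)
  also have "\<dots> = L powr s"
    using K L by (simp add: powr_divide)
  finally have main: "N * (L / real k) powr s \<le> L powr s" .
  have gain: "1/2 \<le> N / real k - 1"
  proof -
    \<comment> \<open>The product equals \<open>2 * N - 3 * k\<close>.\<close>
    have "0 \<le> (real k - 2) * (2 * real k + 1)" using K by simp
    then have "3 * real k \<le> 2 * N" by (simp add: N_def power2_eq_square algebra_simps)
    then show ?thesis using K by (simp add: field_simps)
  qed
  \<comment> \<open>This explains the factor \<open>4 * K ^ 3\<close> in \<open>search_cost\<close>: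
    its linear coefficient \<open>4 * K^2\<close>, times the gain \<open>1/2\<close>, must cover
    \<open>2 * N\<close>.\<close>
  have "2 * N \<le> 4 * (real K)\<^sup>2 * (1/2)"
    using N by simp
  also have "\<dots> \<le> 4 * (real K)\<^sup>2 * (N / real k - 1)"
    using gain by (intro mult_left_mono) auto
  finally have lin: "2 * N * L \<le> 4 * (real K)\<^sup>2 * (N / real k - 1) * L"
    using L by (intro mult_right_mono) auto
  have "N * (2 * L + search_cost K (L / real k))
        = 4 * real K ^ 3 * (N * (L / real k) powr s) - 4 * (real K)\<^sup>2 * (N / real k) * L + 2 * N * L"
    using K by (simp add: search_cost_def s_def field_simps power2_eq_square power3_eq_cube)
  also have "\<dots> \<le> 4 * real K ^ 3 * L powr s - 4 * (real K)\<^sup>2 * (N / real k) * L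
                    + 4 * (real K)\<^sup>2 * (N / real k - 1) * L"
    using mult_left_mono[OF main, of "4 * real K ^ 3"] lin
    by (metis add_mono diff_right_mono of_nat_0_le_iff zero_le_mult_iff zero_le_numeral zero_le_power)
  also have "\<dots> = search_cost K L"
    using K by (simp add: search_cost_def s_def field_simps power2_eq_square power3_eq_cube)
  finally show ?thesis by (simp add: N_def)
qed

section \<open>Correctness and cost of the search\<close>

text \<open>\<open>K\<close> replaces \<beta>: it bounds the fineness of every cut at every time of
  the run.\<close>

locale hunt_run =
  fixes h :: "nat \<Rightarrow> hint" and t :: complex and K :: nat
  assumes K_ge_2: "K \<ge> 2"
    and hint_contains: "\<And>i. t \<in> sector (pos_at h i) (h i)"
    and hint_excludes:
      "\<And>q i. snd q > 0 \<Longrightarrow> \<exists>q' \<in> set (cells q K). square q' \<inter> sector (fst q) (h i) = {}"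
begin

lemma fineness_props:
  assumes "snd q > 0"
  shows "2 \<le> fineness q (h i)" "fineness q (h i) \<le> K"
    "\<exists>q' \<in> set (cells q (fineness q (h i))). square q' \<inter> sector (fst q) (h i) = {}"
proof -
  let ?P = "\<lambda>k. k \<ge> 2 \<and> (\<exists>q' \<in> set (cells q k). square q' \<inter> sector (fst q) (h i) = {})"
  have P: "?P K" using K_ge_2 hint_excludes[OF assms] by blast
  show "2 \<le> fineness q (h i)"
    "\<exists>q' \<in> set (cells q (fineness q (h i))). square q' \<inter> sector (fst q) (h i) = {}"
    using LeastI[of ?P, OF P] unfolding fineness_def by blast+
  show "fineness q (h i) \<le> K"
    using Least_le[of ?P, OF P] unfolding fineness_def by blast
qed

lemma length_live_cells:
  assumes "snd q > 1"
  shows "real (length (live_cells q (h i))) \<le> (real (fineness q (h i)))\<^sup>2 - 1"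
proof -
  obtain q' where "q' \<in> set (cells q (fineness q (h i)))" "square q' \<inter> sector (fst q) (h i) = {}"
    using fineness_props(3)[of q i] assms by force
  then have "length (live_cells q (h i)) < length (cells q (fineness q (h i)))"
    using assms by (auto simp: live_cells_def intro!: length_filter_less)
  then have "length (live_cells q (h i)) + 1 \<le> (fineness q (h i))\<^sup>2"
    by (simp add: length_cells)
  then show ?thesis
    by (metis le_diff_eq of_nat_1 of_nat_add of_nat_le_iff of_nat_power)
qed

text \<open>The move leaving the square, from time \<open>j - 1\<close> to time \<open>j\<close>, is not charged to it.\<close>

definition searched :: "csquare \<Rightarrow> real \<Rightarrow> bool" where
  "searched q B \<longleftrightarrow> (\<forall>i n qs. state_at h i = (n, q # qs) \<longrightarrow>
     (\<exists>j > i. state_at h j = (n, qs) \<and> (\<forall>l \<in> {i..<j}. pos_at h l \<in> square q) \<and>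
        path_length h i (j - 1) \<le> B \<and>
        (t \<in> square q \<longrightarrow> (\<exists>l \<in> {i..<j}. dist (pos_at h l) t \<le> 1))))"

text \<open>Induction along the stack. Each square is charged the move to its centre, which joins
  two points of \<open>square q\<close> and so has length at most \<open>2 * snd q\<close>, plus its
  search cost \<open>B\<close>. The move after time \<open>j\<close> is left to the caller.\<close>

lemma searched_list:
  assumes "\<And>q'. q' \<in> set ps \<Longrightarrow> searched q' B \<and> square q' \<subseteq> square q \<and> 0 \<le> snd q'"
    and "snd q \<ge> 0" and "state_at h (Suc i) = (n, ps @ qs)" and "pos_at h i \<in> square q"
  shows "\<exists>j \<ge> i. state_at h (Suc j) = (n, qs) \<and> (\<forall>l \<in> {i..j}. pos_at h l \<in> square q) \<and>
           path_length h i j \<le> real (length ps) * (2 * snd q + B) \<and>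
           (\<forall>q' \<in> set ps. t \<in> square q' \<longrightarrow> (\<exists>l \<in> {i..j}. dist (pos_at h l) t \<le> 1))"
  using assms
proof (induction ps arbitrary: i)
  case Nil
  then show ?case by (intro exI[of _ i]) (auto simp: path_length_def)
next
  case (Cons p ps)
  have p: "searched p B" "square p \<subseteq> square q" "0 \<le> snd p"
    using Cons.prems by auto
  have "state_at h (Suc i) = (n, p # (ps @ qs))"
    using Cons.prems by simp
  then obtain j where j: "j > Suc i" "state_at h j = (n, ps @ qs)"
      "\<forall>l \<in> {Suc i..<j}. pos_at h l \<in> square p" "path_length h (Suc i) (j - 1) \<le> B"
      "t \<in> square p \<longrightarrow> (\<exists>l \<in> {Suc i..<j}. dist (pos_at h l) t \<le> 1)"
    using p(1) unfolding searched_def by meson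
  \<comment> \<open>The last time of the search of \<open>p\<close>. The induction resumes there, so
    that the move to the next square is charged to the latter.\<close>
  obtain j' where j': "j = Suc j'" "i < j'" using j(1) by (cases j) auto
  have "pos_at h j' \<in> square q" using j(3) j' p(2) by auto
  then obtain m where m: "m \<ge> j'" "state_at h (Suc m) = (n, qs)"
      "\<forall>l \<in> {j'..m}. pos_at h l \<in> square q"
      "path_length h j' m \<le> real (length ps) * (2 * snd q + B)"
      "\<forall>q' \<in> set ps. t \<in> square q' \<longrightarrow> (\<exists>l \<in> {j'..m}. dist (pos_at h l) t \<le> 1)"
    using Cons.IH[of j'] Cons.prems j j' by auto
  have in_q: "\<forall>l \<in> {i..m}. pos_at h l \<in> square q"
  proof
    fix l assume "l \<in> {i..m}"
    then consider "l = i" | "l \<in> {Suc i..<j}" | "l \<in> {j'..m}" using j' by force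
    then show "pos_at h l \<in> square q"
      using j(3) m(3) p(2) Cons.prems(4) by cases blast+
  qed
  have "path_length h i m = path_length h i (Suc i) + path_length h (Suc i) j' + path_length h j' m"
    using j' m(1) path_length_split[of i "Suc i" m h] path_length_split[of "Suc i" j' m h] by simp
  moreover have "path_length h i (Suc i) \<le> 2 * snd q"
    unfolding path_length_Suc using in_q j' m(1) Cons.prems by (intro dist_in_square_le) auto
  ultimately have "path_length h i m \<le> real (length (p # ps)) * (2 * snd q + B)"
    using j(4) j' m(4) by (simp add: algebra_simps)
  moreover have "\<exists>l \<in> {i..m}. dist (pos_at h l) t \<le> 1" if "q' \<in> set (p # ps)" "t \<in> square q'" for q'
  proof (cases "q' = p")
    case True
    then obtain l where "l \<in> {Suc i..<j}" "dist (pos_at h l) t \<le> 1" using j(5) \<open>t \<in> square q'\<close> by blast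
    then show ?thesis using j' m(1) by (intro bexI[of _ l]) auto
  next
    case False
    then obtain l where "l \<in> {j'..m}" "dist (pos_at h l) t \<le> 1"
      using m(5) \<open>q' \<in> set (p # ps)\<close> \<open>t \<in> square q'\<close> by auto
    then show ?thesis using j' by (intro bexI[of _ l]) auto
  qed
  ultimately show ?case
    using m j' in_q by (intro exI[of _ m]) auto
qed

text \<open>The power of 2 is an induction measure: every cut at least halves the side.\<close>

lemma searched_square:
  assumes "snd q \<le> 2 ^ d" "1 / real K \<le> snd q"
  shows "searched q (search_cost K (snd q))"
  using assms
proof (induction d arbitrary: q)
  case 0
  have leaf: "snd q \<le> 1" using 0 by simp
  have pos: "0 \<le> snd q" using 0 by (meson of_nat_0_le_iff order_trans zero_le_divide_1_iff)
  show ?case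
    unfolding searched_def
  proof (intro allI impI)
    fix i n qs
    assume st: "state_at h i = (n, q # qs)"
    then have "state_at h (Suc i) = (n, qs)" "pos_at h i = fst q"
      using leaf by (auto simp: state_at_Suc live_cells_def pos_at_def)
    then show "\<exists>j > i. state_at h j = (n, qs) \<and> (\<forall>l \<in> {i..<j}. pos_at h l \<in> square q) \<and>
        path_length h i (j - 1) \<le> search_cost K (snd q) \<and>
        (t \<in> square q \<longrightarrow> (\<exists>l \<in> {i..<j}. dist (pos_at h l) t \<le> 1))"
      using center_in_square[OF pos] dist_center_le_1[OF _ leaf] search_cost_nonneg[OF K_ge_2 0(2)]
      by (intro exI[of _ "Suc i"]) (auto simp: path_length_def)
  qed
next
  case (Suc d)
  show ?case
  proof (cases "snd q \<le> 1")
    case True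
    then have "snd q \<le> 2 ^ d" by (meson one_le_numeral one_le_power order_trans)
    then show ?thesis using Suc by blast
  next
    case False
    then have q: "1 < snd q" by simp
    show ?thesis
      unfolding searched_def
    proof (intro allI impI)
      fix i n qs
      assume st: "state_at h i = (n, q # qs)"
      define k where "k = fineness q (h i)"
      define ps where "ps = live_cells q (h i)"
      have k: "2 \<le> k" "k \<le> K"
        using fineness_props[of q i] q by (auto simp: k_def)
      have ps: "ps = filter (\<lambda>q'. square q' \<inter> sector (fst q) (h i) \<noteq> {}) (cells q k)"
        using q by (simp add: ps_def live_cells_def k_def)
      have st1: "state_at h (Suc i) = (n, ps @ qs)" and pos: "pos_at h i = fst q"
        using st by (auto simp: state_at_Suc ps_def pos_at_def)
      have "searched q' (search_cost K (snd q / real k)) \<and> square q' \<subseteq> square q \<and> 0 \<le> snd q'"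
        if "q' \<in> set ps" for q'
      proof -
        have q': "q' \<in> set (cells q k)" using that ps by auto
        have side: "snd q' = snd q / real k" using snd_cells[OF q'] .
        have "snd q / real k \<le> 2 ^ Suc d / 2"
          using q k Suc.prems by (intro frac_le) auto
        moreover have "1 / real K \<le> snd q / real k"
          using q k by (intro frac_le) auto
        ultimately have "searched q' (search_cost K (snd q / real k))"
          using Suc.IH[of q'] side by simp
        then show ?thesis using cells_subset[OF q'] q side by simp
      qed
      from searched_list[OF this _ st1] obtain j where j: "j \<ge> i" "state_at h (Suc j) = (n, qs)"
          "\<forall>l \<in> {i..j}. pos_at h l \<in> square q"
          "path_length h i j \<le> real (length ps) * (2 * snd q + search_cost K (snd q / real k))"
          "\<forall>q' \<in> set ps. t \<in> square q' \<longrightarrow> (\<exists>l \<in> {i..j}. dist (pos_at h l) t \<le> 1)"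
        using q pos center_in_square[of q] by force
      have "1 / real K \<le> snd q / real k"
        using q k by (intro frac_le) auto
      \<comment> \<open>Nonnegativity allows the number of live cells to be replaced by its upper
        bound \<open>k^2 - 1\<close>.\<close>
      then have "0 \<le> 2 * snd q + search_cost K (snd q / real k)"
        using search_cost_nonneg[OF K_ge_2] q by (simp add: add_nonneg_nonneg)
      then have "real (length ps) * (2 * snd q + search_cost K (snd q / real k))
          \<le> ((real k)\<^sup>2 - 1) * (2 * snd q + search_cost K (snd q / real k))"
        using length_live_cells[OF q, of i] by (intro mult_right_mono) (auto simp: ps_def k_def)
      also have "\<dots> \<le> search_cost K (snd q)"
        using search_cost_recurrence[OF k] q by simp
      finally have cost: "path_length h i j \<le> search_cost K (snd q)"
        using j(4) by linarith
      have "\<exists>l \<in> {i..j}. dist (pos_at h l) t \<le> 1" if t: "t \<in> square q"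
      proof -
        obtain q' where q': "q' \<in> set (cells q k)" "t \<in> square q'"
          using cells_cover[OF t, of k] q k
          by (metis dual_order.strict_trans not_numeral_le_zero gr0I zero_less_one)
        \<comment> \<open>A cell containing \<open>t\<close> survives, since \<open>t\<close> also
          lies in the sector of the hint.\<close>
        then have "q' \<in> set ps"
          using hint_contains[of i] pos by (auto simp: ps)
        then show ?thesis using j(5) q' by blast
      qed
      then show "\<exists>j > i. state_at h j = (n, qs) \<and> (\<forall>l \<in> {i..<j}. pos_at h l \<in> square q) \<and>
          path_length h i (j - 1) \<le> search_cost K (snd q) \<and>
          (t \<in> square q \<longrightarrow> (\<exists>l \<in> {i..<j}. dist (pos_at h l) t \<le> 1))"
        using j cost by (intro exI[of _ "Suc j"]) (auto simp: atLeastLessThanSuc_atLeastAtMost)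
    qed
  qed
qed

section \<open>Phases with squares of doubling side\<close>

text \<open>The first move is null, the search costs at most \<open>4 * K ^ 3 * L powr s\<close>,
  and the return to the origin at most \<open>2 * L \<le> 2 * K ^ 3 * L powr s\<close>; hence the
  constant 6.\<close>

lemma phase:
  assumes "state_at h i = (n, [])"
  shows "\<exists>j \<ge> i. state_at h j = (Suc n, []) \<and>
           path_length h i j \<le> 6 * real K ^ 3 * (2 powr search_exponent K) ^ Suc n \<and>
           (t \<in> square (0, 2 ^ Suc n) \<longrightarrow> (\<exists>l \<in> {i..<j}. dist (pos_at h l) t \<le> 1))"
proof -
  define L :: real where "L = 2 ^ Suc n"
  define s where "s = search_exponent K"
  have K: "2 \<le> real K" using K_ge_2 by simp
  have L: "1 \<le> L" unfolding L_def by (rule one_le_power) simp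
  have st1: "state_at h (Suc i) = (Suc n, [(0, L)])"
    using assms by (simp add: state_at_Suc L_def)
  have "searched (0, L) (search_cost K L)"
  proof -
    have "1 / real K \<le> L" using K L by (simp add: divide_le_eq mult_ge1_I)
    then show ?thesis
      using searched_square[of "(0, L)" "Suc n"] by (simp add: L_def)
  qed
  then obtain j where j: "j > Suc i" "state_at h j = (Suc n, [])"
      "\<forall>l \<in> {Suc i..<j}. pos_at h l \<in> square (0, L)" "path_length h (Suc i) (j - 1) \<le> search_cost K L"
      "t \<in> square (0, L) \<longrightarrow> (\<exists>l \<in> {Suc i..<j}. dist (pos_at h l) t \<le> 1)"
    using st1 unfolding searched_def by meson
  obtain j' where j': "j = Suc j'" "i < j'" using j(1) by (cases j) auto
  have "path_length h i j = path_length h i (Suc i) + path_length h (Suc i) j' + path_length h j' j"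
    using j' path_length_split[of i "Suc i" j h] path_length_split[of "Suc i" j' j h] by simp
  moreover have "path_length h i (Suc i) = 0"
    using assms st1 by (simp add: path_length_Suc pos_at_def)
  moreover have "path_length h j' j \<le> 2 * L"
  proof -
    have "pos_at h j' \<in> square (0, L)" using j(3) j' by auto
    moreover have "pos_at h (Suc j') = fst ((0, L) :: csquare)"
      using j(2) j' by (simp add: pos_at_def)
    ultimately show ?thesis
      using dist_in_square_le[of "pos_at h j'" "(0, L)" "pos_at h (Suc j')"] L
        center_in_square[of "(0, L)"] by (simp add: j'(1) path_length_Suc)
  qed
  moreover have "search_cost K L \<le> 4 * real K ^ 3 * L powr s"
    using K L by (simp add: search_cost_def s_def mult_left_mono)
  moreover have "2 * L \<le> 2 * real K ^ 3 * L powr s"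
  proof -
    have "L powr 1 \<le> L powr s"
      using L search_exponent_bounds[OF K_ge_2] by (intro powr_mono) (auto simp: s_def)
    moreover have "1 \<le> real K ^ 3" using K by (intro one_le_power) auto
    ultimately show ?thesis
      using L mult_mono[of 1 "real K ^ 3" L "L powr s"] by simp
  qed
  ultimately have "path_length h i j \<le> 6 * real K ^ 3 * L powr s"
    using j(4) j'(1) by simp
  also have "L powr s = (2 powr s) ^ Suc n"
    by (simp add: L_def powr_power powr_realpow[symmetric] powr_powr mult.commute powr_mult powr_add
        del: power_Suc)
  finally show ?thesis
    using j by (intro exI[of _ j]) (auto simp: s_def L_def)
qed

text \<open>The phase bounds form a geometric series of ratio at least 2, so their sum is at most
  twice the last one.\<close>

lemma phase_start:
  "\<exists>i. state_at h i = (n, []) \<and> path_length h 0 i \<le> 12 * real K ^ 3 * (2 powr search_exponent K) ^ n"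
proof (induction n)
  case 0
  then show ?case by (intro exI[of _ 0]) (simp add: state_at_0 path_length_def)
next
  case (Suc n)
  let ?x = "2 powr search_exponent K"
  have x: "2 \<le> ?x"
    using search_exponent_bounds(1)[OF K_ge_2] powr_mono[of 1 "search_exponent K" 2] by simp
  obtain i where i: "state_at h i = (n, [])" "path_length h 0 i \<le> 12 * real K ^ 3 * ?x ^ n"
    using Suc by blast
  obtain j where j: "j \<ge> i" "state_at h j = (Suc n, [])"
      "path_length h i j \<le> 6 * real K ^ 3 * ?x ^ Suc n"
    using phase[OF i(1)] by blast
  have "6 * real K ^ 3 * ?x ^ n * 2 \<le> 6 * real K ^ 3 * ?x ^ n * ?x"
    using x by (intro mult_left_mono) auto
  then have "path_length h 0 j \<le> 12 * real K ^ 3 * ?x ^ Suc n"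
    using i j path_length_split[of 0 i j h] by (simp add: algebra_simps)
  then show ?case using j by blast
qed

text \<open>The treasure is met at the latest in a phase whose square has half side
  \<open>2 ^ n\<close> with \<open>D \<le> 2 ^ n \<le> 2 * D\<close>.\<close>

lemma found:
  assumes D: "D > 1" "dist 0 t \<le> D"
  shows "\<exists>l. dist (pos_at h l) t \<le> 1 \<and>
             path_length h 0 l \<le> 200 * real K ^ 3 * D powr search_exponent K"
proof -
  define s where "s = search_exponent K"
  have s: "1 < s" "s < 2" using search_exponent_bounds[OF K_ge_2] by (auto simp: s_def)
  define n where "n = nat \<lfloor>log 2 D\<rfloor> + 1"
  have lD: "0 < log 2 D" using D by simp
  have n: "log 2 D \<le> real n" "real n \<le> log 2 D + 1"
    unfolding n_def using lD by linarith+
  have Dn: "D \<le> 2 ^ n"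
  proof -
    have "D = 2 powr log 2 D" using D by simp
    also have "\<dots> \<le> 2 powr real n" using n by (intro powr_mono) auto
    finally show ?thesis by (simp add: powr_realpow)
  qed
  have nD: "2 ^ Suc n \<le> 4 * D"
  proof -
    have "(2::real) ^ Suc n = 2 powr (real n + 1)" by (simp add: powr_realpow powr_add)
    also have "\<dots> \<le> 2 powr (log 2 D + 2)" using n by (intro powr_mono) auto
    also have "\<dots> = 4 * D" using D by (simp add: powr_add)
    finally show ?thesis .
  qed
  have t: "t \<in> square (0, 2 ^ Suc n)"
    using D Dn abs_Re_le_cmod[of t] abs_Im_le_cmod[of t] by (simp add: square_def dist_norm)
  let ?x = "2 powr s"
  have x: "2 \<le> ?x" using s powr_mono[of 1 s 2] by simp
  obtain i where i: "state_at h i = (n, [])" "path_length h 0 i \<le> 12 * real K ^ 3 * ?x ^ n"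
    using phase_start unfolding s_def by blast
  obtain j l where j: "path_length h i j \<le> 6 * real K ^ 3 * ?x ^ Suc n"
      "l \<in> {i..<j}" "dist (pos_at h l) t \<le> 1"
    using phase[OF i(1)] t unfolding s_def by blast
  have "path_length h 0 l \<le> path_length h 0 i + path_length h i j"
    using j(2) path_length_split[of 0 i l h] path_length_split[of i l j h] path_length_nonneg[of h l j]
    by simp
  also have "\<dots> \<le> 12 * real K ^ 3 * ?x ^ Suc n"
  proof -
    have "6 * real K ^ 3 * ?x ^ n * 2 \<le> 6 * real K ^ 3 * ?x ^ n * ?x"
      using x by (intro mult_left_mono) auto
    then show ?thesis using i(2) j(1) by (simp add: algebra_simps)
  qed
  also have "?x ^ Suc n = (2 ^ Suc n) powr s"
    by (simp add: powr_power powr_realpow[symmetric] powr_powr mult.commute del: power_Suc)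
  also have "\<dots> \<le> (4 * D) powr s"
    using nD s by (intro powr_mono2) auto
  also have "\<dots> = 4 powr s * D powr s"
    using D by (simp add: powr_mult)
  \<comment> \<open>The final constant is \<open>12 * 16 = 192\<close>, rounded up to 200.\<close>
  also have "4 powr s \<le> (16 :: real)"
    using s powr_mono[of s 2 4] by simp
  finally have "path_length h 0 l \<le> 12 * real K ^ 3 * (16 * D powr s)"
    by (simp add: mult_left_mono mult_right_mono)
  also have "\<dots> \<le> 200 * real K ^ 3 * D powr s"
    by (simp add: mult_right_mono)
  finally show ?thesis using j(3) s_def by blast
qed

end

theorem theorem2:
  "\<exists>A :: algorithm. \<forall>\<beta> :: real. 0 < \<beta> \<and> \<beta> < 2 * pi \<longrightarrow>
     (\<exists>\<epsilon> C :: real. \<epsilon> > 0 \<and> C > 0 \<and>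
        (\<forall>(D :: real) (t :: complex) (h :: nat \<Rightarrow> hint).
           D > 1 \<longrightarrow> dist 0 t \<le> D \<longrightarrow> consistent_hints A h t \<longrightarrow> (\<forall>i. hint_size (h i) \<le> \<beta>) \<longrightarrow>
           finds_within A h t (C * D powr (2 - \<epsilon>))))"
proof (intro exI[of _ hunt] allI impI)
  fix \<beta> :: real
  assume "0 < \<beta> \<and> \<beta> < 2 * pi"
  then obtain K where K: "K \<ge> 2" and excl:
      "\<And>q a. \<lbrakk>snd q > 0; snd a \<le> \<beta>\<rbrakk> \<Longrightarrow> \<exists>q' \<in> set (cells q K). square q' \<inter> sector (fst q) a = {}"
    using excluded_cell_exists by metis
  have "finds_within hunt h t (200 * real K ^ 3 * D powr (2 - (2 - search_exponent K)))"
    if D: "D > 1" "dist 0 t \<le> D" and h: "consistent_hints hunt h t" "\<forall>i. hint_size (h i) \<le> \<beta>"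
    for D t h
  proof -
    interpret hunt_run h t K
      using K excl h by unfold_locales (auto simp: consistent_hints_def position_hunt hint_size_def)
    obtain l where l: "dist (pos_at h l) t \<le> 1"
        "path_length h 0 l \<le> 200 * real K ^ 3 * D powr search_exponent K"
      using found[OF D] by blast
    have "(\<Sum>j<l. norm (move hunt h j)) = path_length h 0 l"
      by (simp add: path_length_def move_hunt dist_norm norm_minus_commute atLeast0LessThan)
    then show ?thesis
      \<comment> \<open>Fraction 0 of move \<open>l\<close>: the treasure is found at a point where
        a hint is received.\<close>
      unfolding finds_within_def using l by (intro exI[of _ l] exI[of _ 0]) (simp add: position_hunt)
  qed
  then show "\<exists>\<epsilon> C :: real. \<epsilon> > 0 \<and> C > 0 \<and>
        (\<forall>(D :: real) (t :: complex) (h :: nat \<Rightarrow> hint).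
           D > 1 \<longrightarrow> dist 0 t \<le> D \<longrightarrow> consistent_hints hunt h t \<longrightarrow> (\<forall>i. hint_size (h i) \<le> \<beta>) \<longrightarrow>
           finds_within hunt h t (C * D powr (2 - \<epsilon>)))"
    \<comment> \<open>Both constants depend on \<beta> through \<open>K\<close> only, and
      \<open>search_exponent K < 2\<close> makes \<epsilon> positive.\<close>
    using K search_exponent_bounds[OF K]
    by (intro exI[of _ "2 - search_exponent K"] exI[of _ "200 * real K ^ 3"]) auto
qed

end
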